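(* If $G$ and $H$ are finite connected graphs, then $\sigma(G \circ H) \leq \sigma(G)\,|V(H)| + \sigma(H)$, where $G \circ H$ is the lexicographic product.
   Context: Surrounding Cops and Robbers on a finite simple graph $G$ with $k \geq 1$ cops and one robber: the cops first choose starting vertices (several cops may share a vertex), then the robber chooses a starting vertex not occupied by a cop, and thereafter the cops and the robber alternate moves, the cops moving first. In a move, each player may move to an adjacent vertex or stay put; the robber may never move to, or remain on, a vertex occupied by a cop, so if a cop moves onto the robber's vertex the robber is compelled to move to a neighbouring vertex not occupied by a cop. The cops win if at any time every neighbour of the robber's vertex is occupied by a cop; the robber wins if he avoids this forever. Play is with perfect information. The surrounding cop number $\sigma(G)$ is the least number of cops for which the cops have a winning strategy. The lexicographic product $G \circ H$ has vertex set $V(G)\times V(H)$, with $(g,h)$ adjacent to $(g',h')$ iff $gg' \in E(G)$, or $g = g'$ and $hh' \in E(H)$. *)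

theory Defs
  imports "Graph_Theory.Digraph_Component"
begin

definition lex_product ::
  "'a pair_pre_digraph \<Rightarrow> 'b pair_pre_digraph \<Rightarrow> ('a \<times> 'b) pair_pre_digraph" where
  "lex_product G H =
     \<lparr> pverts = pverts G \<times> pverts H,
       parcs = {((g, h), (g', h')) | g h g' h'.
         g \<in> pverts G \<and> h \<in> pverts H \<and> g' \<in> pverts G \<and> h' \<in> pverts H \<and>
         ((g, g') \<in> parcs G \<or> g = g' \<and> (h, h') \<in> parcs H)} \<rparr>"

lemma pair_graph_lex_product:
  assumes "pair_graph G" "pair_graph H"
  shows "pair_graph (lex_product G H)"
proof -
  interpret G: pair_graph G by fact
  interpret H: pair_graph H by fact
  have "parcs (lex_product G H) \<subseteq> (pverts G \<times> pverts H) \<times> (pverts G \<times> pverts H)"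
    by (auto simp: lex_product_def)
  moreover have "finite (pverts G \<times> pverts H)" by simp
  ultimately have "finite (parcs (lex_product G H))"
    by (meson finite_SigmaI finite_subset)
  then show ?thesis
    by unfold_locales
      (auto simp: lex_product_def symmetric_def sym_def
        dest: G.pair_no_loops H.pair_no_loops G.arcs_symmetric H.arcs_symmetric)
qed

definition may_move :: "'v pair_pre_digraph \<Rightarrow> 'v \<Rightarrow> 'v \<Rightarrow> bool" where
  "may_move G u v \<longleftrightarrow> u = v \<or> (u, v) \<in> parcs G"

text \<open>
  A position of \<open>k\<close> cops is a function \<open>c\<close> on the indices \<open>i < k\<close>; its other values are irrelevant.
\<close>

definition occupied :: "nat \<Rightarrow> (nat \<Rightarrow> 'v) \<Rightarrow> 'v set" where
  "occupied k c = c ` {..<k}"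

definition surrounded :: "'v pair_pre_digraph \<Rightarrow> nat \<Rightarrow> (nat \<Rightarrow> 'v) \<Rightarrow> 'v \<Rightarrow> bool" where
  "surrounded G k c r \<longleftrightarrow> {w. (r, w) \<in> parcs G} \<subseteq> occupied k c"

text \<open>
  A cop strategy assigns a cop position to every finite sequence of robber positions seen so far
  (the past cop positions are determined by the strategy and this sequence): \<open>s []\<close> is the initial
  placement, and \<open>s [r\<^sub>0, \<dots>, r\<^sub>n]\<close> is where the cops move to in reply to \<open>r\<^sub>n\<close>.
\<close>

definition cop_strategy ::
  "'v pair_pre_digraph \<Rightarrow> nat \<Rightarrow> ('v list \<Rightarrow> nat \<Rightarrow> 'v) \<Rightarrow> bool" where
  "cop_strategy G k s \<longleftrightarrow>
     (\<forall>i<k. s [] i \<in> pverts G) \<and>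
     (\<forall>rs r. set rs \<subseteq> pverts G \<longrightarrow> r \<in> pverts G \<longrightarrow>
        (\<forall>i<k. may_move G (s rs i) (s (rs @ [r]) i)))"

text \<open>
  The robber position \<open>r n\<close> is chosen when the cops are at \<open>cops_at s r n\<close>; the cops then move to
  \<open>cops_at s r (Suc n)\<close>.
\<close>

definition cops_at :: "('v list \<Rightarrow> nat \<Rightarrow> 'v) \<Rightarrow> (nat \<Rightarrow> 'v) \<Rightarrow> nat \<Rightarrow> nat \<Rightarrow> 'v" where
  "cops_at s r n = s (map r [0..<n])"

definition robber_play ::
  "'v pair_pre_digraph \<Rightarrow> nat \<Rightarrow> ('v list \<Rightarrow> nat \<Rightarrow> 'v) \<Rightarrow> (nat \<Rightarrow> 'v) \<Rightarrow> bool" where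
  "robber_play G k s r \<longleftrightarrow>
     r 0 \<in> pverts G \<and>
     (\<forall>n. may_move G (r n) (r (Suc n))) \<and>
     (\<forall>n. r n \<notin> occupied k (cops_at s r n))"

text \<open>
  It suffices to consider infinite plays: a robber who is not surrounded always has a legal move.
  A robber who finds no unoccupied starting vertex loses.
\<close>

definition winning_cop_strategy ::
  "'v pair_pre_digraph \<Rightarrow> nat \<Rightarrow> ('v list \<Rightarrow> nat \<Rightarrow> 'v) \<Rightarrow> bool" where
  "winning_cop_strategy G k s \<longleftrightarrow>
     cop_strategy G k s \<and>
     (\<forall>r. robber_play G k s r \<longrightarrow>
        (\<exists>n. surrounded G k (cops_at s r n) (r n) \<or>
             surrounded G k (cops_at s r (Suc n)) (r n)))"

definition cops_win :: "'v pair_pre_digraph \<Rightarrow> nat \<Rightarrow> bool" where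
  "cops_win G k \<longleftrightarrow> (\<exists>s. winning_cop_strategy G k s)"

definition surrounding_cop_number :: "'v pair_pre_digraph \<Rightarrow> nat" where
  "surrounding_cop_number G = (LEAST k. k \<ge> 1 \<and> cops_win G k)"

lemma cops_win_card:
  assumes "finite (pverts G)"
  shows "cops_win G (card (pverts G))"
proof -
  obtain c where c: "bij_betw c {..<card (pverts G)} (pverts G)"
    using ex_bij_betw_nat_finite[OF assms] by (auto simp: atLeast0LessThan)
  then have "occupied (card (pverts G)) c = pverts G"
    by (auto simp: occupied_def bij_betw_def)
  then have "\<not> robber_play G (card (pverts G)) (\<lambda>_. c) r" for r
    by (auto simp: robber_play_def cops_at_def)
  moreover have "cop_strategy G (card (pverts G)) (\<lambda>_. c)"
    using bij_betwE[OF c] by (auto simp: cop_strategy_def may_move_def)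
  ultimately show ?thesis
    by (auto simp: cops_win_def winning_cop_strategy_def)
qed

lemma surrounding_cop_number:
  assumes "finite (pverts G)" "pverts G \<noteq> {}"
  shows "surrounding_cop_number G \<ge> 1" "cops_win G (surrounding_cop_number G)"
proof -
  have "card (pverts G) \<ge> 1"
    using assms by (simp add: Suc_leI card_gt_0_iff)
  with cops_win_card[OF assms(1)]
  have "surrounding_cop_number G \<ge> 1 \<and> cops_win G (surrounding_cop_number G)"
    unfolding surrounding_cop_number_def by (intro LeastI conjI)
  then show "surrounding_cop_number G \<ge> 1" "cops_win G (surrounding_cop_number G)"
    by auto
qed

end

theory Submission
  imports Defs
begin

text \<open>
  For each of the \<open>\<sigma>(G)\<close> cops of the game on \<open>G\<close>, a squad of \<open>|V(H)|\<close> cops fills the whole fibre over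
  that cop's vertex and moves from fibre to fibre as the cop does.  The projection of the robber is
  then a legal robber in the game on \<open>G\<close>, so at some point every fibre adjacent to the robber's
  fibre is full.  The squads stay there for good and the robber is confined to his fibre.  By
  connectedness the \<open>\<sigma>(H)\<close> remaining cops can walk to that fibre, take up the initial
  placement of a winning strategy on \<open>H\<close>, and play it against the robber.
\<close>

section \<open>Winning positions as an inductive predicate\<close>

text \<open>
  Cops at \<open>c\<close>, robber at \<open>r\<close>, cops to move.  A robber surrounded after the cops' move needs no rule of
  its own: his only possible reply is to stay, and then he is surrounded at the next turn.
\<close>

inductive cops_force ::
  "'v pair_pre_digraph \<Rightarrow> nat \<Rightarrow> (nat \<Rightarrow> 'v) \<Rightarrow> 'v \<Rightarrow> bool" for G k where
  now: "surrounded G k c r \<Longrightarrow> cops_force G k c r"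
| move: "\<forall>i<k. may_move G (c i) (c' i) \<Longrightarrow>
    (\<And>r'. may_move G r r' \<Longrightarrow> r' \<notin> occupied k c' \<Longrightarrow> cops_force G k c' r') \<Longrightarrow>
    cops_force G k c r"

lemma cops_force_surrounded_after:
  assumes "\<forall>i<k. may_move G (c i) (c' i)" "surrounded G k c' r"
  shows "cops_force G k c r"
  using assms(1)
proof (rule cops_force.move)
  fix r' assume "may_move G r r'" "r' \<notin> occupied k c'"
  then have "r' = r"
    using assms(2) by (auto simp: may_move_def surrounded_def)
  then show "cops_force G k c' r'"
    using assms(2) by (simp add: cops_force.now)
qed

text \<open>At a position outside \<open>cops_force\<close> every legal cop move, in particular the
  one made by \<open>s\<close>, leaves the robber a reply that is again outside. Dependent choice
  strings these replies into an infinite play against \<open>s\<close>. Since \<open>s\<close> wins,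
  that play reaches a surrounded robber, hence a position in \<open>cops_force\<close>: a
  contradiction.\<close>

lemma winning_cop_strategy_imp_cops_force:
  assumes win: "winning_cop_strategy G k s" and wf: "parcs G \<subseteq> pverts G \<times> pverts G"
    and r0: "r0 \<in> pverts G" "r0 \<notin> occupied k (s [])"
  shows "cops_force G k (s []) r0"
proof (rule ccontr)
  assume not_forced: "\<not> cops_force G k (s []) r0"
  \<comment> \<open>\<open>rs\<close> is the robber's history so far. He chose
    \<open>last rs\<close> facing the cops at \<open>s (butlast rs)\<close>, so that is the position
    with the cops to move.\<close>
  define P where "P = (\<lambda>(n::nat) rs. length rs = Suc n \<and> set rs \<subseteq> pverts G \<and> hd rs = r0 \<and>
    last rs \<notin> occupied k (s (butlast rs)) \<and> \<not> cops_force G k (s (butlast rs)) (last rs))"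
  define Q where "Q = (\<lambda>(n::nat) rs rs'. \<exists>x. rs' = rs @ [x] \<and> may_move G (last rs) x)"
  have legal: "\<forall>i<k. may_move G (s rs i) (s (rs @ [x]) i)"
    if "set rs \<subseteq> pverts G" "x \<in> pverts G" for rs x
    using win that by (auto simp: winning_cop_strategy_def cop_strategy_def)
  have "\<exists>rs. P 0 rs"
    using not_forced r0 by (intro exI[of _ "[r0]"]) (simp add: P_def)
  moreover have "\<exists>rs'. P (Suc n) rs' \<and> Q n rs rs'" if Pn: "P n rs" for n rs
  proof -
    have "rs \<noteq> []" and verts: "set rs \<subseteq> pverts G"
      using Pn by (auto simp: P_def)
    then have rs: "butlast rs @ [last rs] = rs" and sub: "last rs \<in> pverts G"
      using last_in_set[of rs] by auto
    have mv: "\<forall>i<k. may_move G (s (butlast rs) i) (s rs i)"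
      using legal[of "butlast rs" "last rs"] verts sub unfolding rs 
      by (meson in_set_butlastD subset_iff)
    obtain x where x: "may_move G (last rs) x" "x \<notin> occupied k (s rs)" "\<not> cops_force G k (s rs) x"
      using Pn cops_force.move[OF mv, of "last rs"] unfolding P_def by metis
    have "x \<in> pverts G"
      using x(1) sub wf unfolding may_move_def by blast
    then have "P (Suc n) (rs @ [x])"
      using Pn x \<open>rs \<noteq> []\<close> by (simp add: P_def)
    then show ?thesis
      using x(1) by (auto simp: Q_def)
  qed
  ultimately obtain f where f: "\<And>n. P n (f n)" "\<And>n. Q n (f n) (f (Suc n))"
    using dependent_nat_choice[of P Q] by metis
  define r where "r n = last (f n)" for n
  \<comment> \<open>By \<open>Q\<close> each history extends the previous one by one entry, so all
    of them are prefixes of the single play \<open>r\<close>.\<close>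
  have f_map: "f n = map r [0..<Suc n]" for n
  proof (induction n)
    case 0
    have "length (f 0) = Suc 0"
      using f(1)[of 0] by (simp add: P_def)
    then show ?case
      by (cases "f 0") (auto simp: r_def)
  next
    case (Suc n)
    then show ?case
      using f(2)[of n] by (auto simp: Q_def r_def)
  qed
  have before: "butlast (f n) = map r [0..<n]" for n
    by (simp add: f_map)
  have escape: "r n \<notin> occupied k (cops_at s r n)" "\<not> cops_force G k (cops_at s r n) (r n)"
    and verts: "set (map r [0..<Suc n]) \<subseteq> pverts G" for n
    using f(1)[of n] unfolding P_def before r_def[symmetric]
    by (simp_all only: cops_at_def f_map[of n, symmetric]) simp_all
  have "may_move G (r n) (r (Suc n))" for n
    using f(2)[of n] by (auto simp: Q_def r_def)
  moreover have "r 0 \<in> pverts G"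
    using verts[of 0] by simp
  ultimately have "robber_play G k s r"
    using escape(1) by (simp add: robber_play_def)
  then obtain n where
    "surrounded G k (cops_at s r n) (r n) \<or> surrounded G k (cops_at s r (Suc n)) (r n)"
    using win by (auto simp: winning_cop_strategy_def)
  moreover have "\<forall>i<k. may_move G (cops_at s r n i) (cops_at s r (Suc n) i)"
    using legal[of "map r [0..<n]" "r n"] verts[of n] by (simp add: cops_at_def)
  ultimately have "cops_force G k (cops_at s r n) (r n)"
    using cops_force.now[of G k] cops_force_surrounded_after[of k G] by metis
  with escape(2) show False ..
qed

section \<open>From winning positions back to strategies\<close>

text \<open>Legality is demanded for every history, even an impossible one, so that strategies can
  be glued together without side conditions.\<close>

definition legal_replies :: "'v pair_pre_digraph \<Rightarrow> nat \<Rightarrow> ('v list \<Rightarrow> nat \<Rightarrow> 'v) \<Rightarrow> bool" where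
  "legal_replies G k s \<longleftrightarrow> (\<forall>rs r. \<forall>i<k. may_move G (s rs i) (s (rs @ [r]) i))"

text \<open>The surrounding has to occur with the cops to move, which is stronger than in the game:
  \<open>cops_force\<close> turns a surrounding after the cops' move into one of this kind.\<close>

definition wins_against ::
  "'v pair_pre_digraph \<Rightarrow> nat \<Rightarrow> ('v list \<Rightarrow> nat \<Rightarrow> 'v) \<Rightarrow> 'v \<Rightarrow> bool" where
  "wins_against G k s r0 \<longleftrightarrow>
     (\<forall>r. r 0 = r0 \<longrightarrow> (\<forall>n. may_move G (r n) (r (Suc n))) \<longrightarrow>
        (\<forall>n. r n \<notin> occupied k (cops_at s r n)) \<longrightarrow>
        (\<exists>n. surrounded G k (cops_at s r n) (r n)))"

text \<open>All candidates agree on the empty history, so it does not matter that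
  \<open>hd []\<close> is unspecified, and the first reply may already follow the strategy selected
  by the robber's first vertex.\<close>

lemma legal_replies_select:
  assumes "\<And>x. legal_replies G k (S x)" "\<And>x. S x [] = c"
  shows "legal_replies G k (\<lambda>rs. S (hd rs) rs)"
  unfolding legal_replies_def
proof (intro allI impI)
  fix rs r i assume "i < k"
  then show "may_move G (S (hd rs) rs i) (S (hd (rs @ [r])) (rs @ [r]) i)"
    using assms(1)[of "hd (rs @ [r])"] assms(2) 
    by (cases "rs = []") (auto simp: legal_replies_def dest: spec[of _ "[]"])
qed

text \<open>Induction on \<open>cops_force\<close>: a surrounded robber is met by standing still;
  otherwise the cops move to \<open>c'\<close> and then follow the strategy that the induction
  hypothesis gives for the robber's reply.\<close>

lemma cops_force_imp_strategy:
  assumes "cops_force G k c r0"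
  shows "\<exists>s. s [] = c \<and> legal_replies G k s \<and> wins_against G k s r0"
  using assms
proof induction
  case (now c r)
  then show ?case
    by (intro exI[of _ "\<lambda>_. c"])
      (auto simp: legal_replies_def may_move_def wins_against_def cops_at_def)
next
  case (move c c' r)
  define ok where "ok x \<longleftrightarrow> may_move G r x \<and> x \<notin> occupied k c'" for x
  \<comment> \<open>Against a vertex that is no legal reply the cops stand still, which makes the
    choice of \<open>S\<close> total and every \<open>S x\<close> legal.\<close>
  have "\<exists>t. t [] = c' \<and> legal_replies G k t \<and> (ok x \<longrightarrow> wins_against G k t x)" for x
  proof (cases "ok x")
    case True
    then show ?thesis
      using move.IH by (auto simp: ok_def)
  next
    case False
    then show ?thesis
      by (intro exI[of _ "\<lambda>_. c'"]) (auto simp: legal_replies_def may_move_def)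
  qed
  then obtain S where S: "\<And>x. S x [] = c'" "\<And>x. legal_replies G k (S x)"
    "\<And>x. ok x \<Longrightarrow> wins_against G k (S x) x"
    by metis
  \<comment> \<open>The first entry of the history is \<open>r\<close> itself and is dropped. The
    history \<open>[r]\<close> yields \<open>c'\<close>, since \<open>S x []\<close> is
    \<open>c'\<close> for every \<open>x\<close>; from the second entry on, \<open>hd ys\<close> is
    the reply that selects the strategy.\<close>
  define s where "s rs = (case rs of [] \<Rightarrow> c | _ # ys \<Rightarrow> S (hd ys) ys)" for rs
  have "legal_replies G k s"
    unfolding legal_replies_def
  proof (intro allI impI)
    fix rs x i assume "i < k"
    then show "may_move G (s rs i) (s (rs @ [x]) i)"
      using move.hyps legal_replies_select[of G k S, OF S(2,1)] S(1)
      by (cases rs) (simp_all add: s_def legal_replies_def)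
  qed
  moreover have "wins_against G k s r"
    unfolding wins_against_def
  proof (intro allI impI)
    fix p assume p: "p 0 = r" "\<forall>n. may_move G (p n) (p (Suc n))"
      "\<forall>n. p n \<notin> occupied k (cops_at s p n)"
    define q where "q n = p (Suc n)" for n
    have shift: "cops_at s p (Suc n) = cops_at (S (q 0)) q n" for n
    proof -
      have "map p [0..<Suc n] = p 0 # map q [0..<n]"
        by (simp add: map_upt_Suc q_def del: upt_Suc)
      then show ?thesis
        unfolding cops_at_def by (cases n) (simp_all add: s_def S(1) map_upt_Suc del: upt_Suc map_eq_conv)
    qed
    have "ok (q 0)"
      using p(1) p(2)[rule_format, of 0] p(3)[rule_format, of 1] shift[of 0]
      by (simp add: ok_def q_def cops_at_def S(1))
    moreover have "\<forall>n. may_move G (q n) (q (Suc n))" "\<forall>n. q n \<notin> occupied k (cops_at (S (q 0)) q n)"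
      using p(2,3) unfolding shift[symmetric] by (simp_all add: q_def)
    ultimately obtain n where "surrounded G k (cops_at (S (q 0)) q n) (q n)"
      using S(3) by (metis wins_against_def)
    then have "surrounded G k (cops_at s p (Suc n)) (p (Suc n))"
      using shift by (simp add: q_def)
    then show "\<exists>n. surrounded G k (cops_at s p n) (p n)" ..
  qed
  ultimately show ?case
    by (intro exI[of _ s] conjI) (auto simp: s_def[of "[]"])
qed

text \<open>The robber's starting vertex selects a strategy; all of these share the initial
  placement \<open>c\<close>, so they combine into one.\<close>

lemma cops_winI:
  assumes "\<forall>i<k. c i \<in> pverts G"
    and "\<And>r. r \<in> pverts G \<Longrightarrow> r \<notin> occupied k c \<Longrightarrow> cops_force G k c r"
  shows "cops_win G k"
proof -
  define ok where "ok r \<longleftrightarrow> r \<in> pverts G \<and> r \<notin> occupied k c" for r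
  have "\<exists>s. s [] = c \<and> legal_replies G k s \<and> (ok r \<longrightarrow> wins_against G k s r)" for r
  proof (cases "ok r")
    case True
    then show ?thesis
      using assms(2) cops_force_imp_strategy by (metis ok_def)
  next
    case False
    then show ?thesis
      by (intro exI[of _ "\<lambda>_. c"]) (auto simp: legal_replies_def may_move_def)
  qed
  then obtain S where S: "\<And>x. S x [] = c" "\<And>x. legal_replies G k (S x)"
    "\<And>x. ok x \<Longrightarrow> wins_against G k (S x) x"
    by metis
  define s where "s rs = S (hd rs) rs" for rs
  have "legal_replies G k s"
    unfolding s_def using S(2,1) by (rule legal_replies_select[of G k S])
  then have "cop_strategy G k s"
    using assms(1) S(1) by (auto simp: cop_strategy_def legal_replies_def s_def)
  moreover have "\<exists>n. surrounded G k (cops_at s r n) (r n)" if "robber_play G k s r" for r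
  proof -
    have at: "cops_at s r n = cops_at (S (r 0)) r n" for n
      by (cases n) (simp_all add: cops_at_def s_def S(1) map_upt_Suc del: upt_Suc)
    have "r 0 \<notin> occupied k c"
      using that S(1) by (auto simp: robber_play_def cops_at_def s_def dest: spec[of _ 0])
    then have "wins_against G k (S (r 0)) (r 0)"
      using that by (intro S(3)) (simp add: ok_def robber_play_def)
    then show ?thesis
      using that by (simp add: wins_against_def robber_play_def at)
  qed
  ultimately show ?thesis
    unfolding cops_win_def winning_cop_strategy_def by blast
qed

lemma cops_winD:
  assumes "cops_win G k" and "parcs G \<subseteq> pverts G \<times> pverts G"
  obtains c where "\<forall>i<k. c i \<in> pverts G"
    and "\<And>r. r \<in> pverts G \<Longrightarrow> r \<notin> occupied k c \<Longrightarrow> cops_force G k c r"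
proof -
  obtain s where s: "winning_cop_strategy G k s"
    using assms(1) by (auto simp: cops_win_def)
  show thesis
  proof (rule that[of "s []"])
    show "\<forall>i<k. s [] i \<in> pverts G"
      using s by (simp add: winning_cop_strategy_def cop_strategy_def)
  qed (rule winning_cop_strategy_imp_cops_force[OF s assms(2)])
qed

section \<open>Walking cops to prescribed vertices\<close>

text \<open>The cops walk one after another while the others stand still, so walks of different
  lengths cause no trouble.\<close>

lemma rtranclp_may_move_simultaneous:
  fixes k :: nat
  assumes "\<forall>i<k. (may_move G)\<^sup>*\<^sup>* (c i) (t i)"
  shows "(\<lambda>c c'. \<forall>i<k. may_move G (c i) (c' i))\<^sup>*\<^sup>* c t"
proof -
  define R where "R = (\<lambda>c c'. \<forall>i<k. may_move G (c i) (c' i))"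
  have one: "R\<^sup>*\<^sup>* d (d(j := x))" if "(may_move G)\<^sup>*\<^sup>* (d j) x" for d j x
    using that
  proof induction
    case base
    show ?case by simp
  next
    case (step y z)
    have "R (d(j := y)) (d(j := z))"
      using step.hyps by (auto simp: R_def may_move_def)
    with step.IH show ?case
      by (rule rtranclp.rtrancl_into_rtrancl[of R])
  qed
  have "R\<^sup>*\<^sup>* c (\<lambda>i. if i < j then t i else c i)" if "j \<le> k" for j
    using that
  proof (induction j)
    case 0
    show ?case by simp
  next
    case (Suc j)
    let ?d = "\<lambda>i. if i < j then t i else c i"
    have "R\<^sup>*\<^sup>* ?d (?d(j := t j))"
      using assms Suc.prems by (intro one) auto
    moreover have "?d(j := t j) = (\<lambda>i. if i < Suc j then t i else c i)"
      by (auto simp: fun_eq_iff less_Suc_eq)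
    ultimately show ?case
      using Suc by (metis (no_types, lifting) Suc_leD rtranclp_trans)
  qed
  then have "R\<^sup>*\<^sup>* c (\<lambda>i. if i < k then t i else c i)"
    by simp
  \<comment> \<open>A last step in which no cop moves: it only adjusts the irrelevant values at
    indices from \<open>k\<close> on.\<close>
  moreover have "R (\<lambda>i. if i < k then t i else c i) t"
    by (auto simp: R_def may_move_def)
  ultimately have "R\<^sup>*\<^sup>* c t"
    by (rule rtranclp.rtrancl_into_rtrancl[of R])
  then show ?thesis
    by (simp add: R_def)
qed

lemma connected_rtranclp_may_move:
  assumes "pair_graph G" "Digraph_Component.connected (with_proj G)"
    and "u \<in> pverts G" "v \<in> pverts G"
  shows "(may_move G)\<^sup>*\<^sup>* u v"
proof -
  interpret pair_graph G by fact
  have "(u, v) \<in> rtrancl_on (pverts G) ((parcs G)\<^sup>s)"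
    using assms(2-4) by (simp add: connected_conv)
  then show ?thesis
  proof induction
    case base
    show ?case by simp
  next
    case (step y z)
    then have "may_move G y z"
      using arcs_symmetric by (auto simp: may_move_def symcl_def)
    then show ?case
      using step.IH by (rule converse_rtranclp_into_rtranclp)
  qed
qed

text \<open>Walk in \<open>G\<close> with the \<open>H\<close>-coordinate fixed, then in
  \<open>H\<close> inside the final fibre.\<close>

lemma rtranclp_may_move_lex_product:
  assumes "pair_graph G" "Digraph_Component.connected (with_proj G)"
    and "pair_graph H" "Digraph_Component.connected (with_proj H)"
    and "u \<in> pverts (lex_product G H)" "v \<in> pverts (lex_product G H)"
  shows "(may_move (lex_product G H))\<^sup>*\<^sup>* u v"
proof -
  interpret G: pair_graph G by fact
  interpret H: pair_graph H by fact
  let ?M = "may_move (lex_product G H)"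
  obtain g h g' h' where uv: "u = (g, h)" "v = (g', h')"
    and V: "g \<in> pverts G" "h \<in> pverts H" "g' \<in> pverts G" "h' \<in> pverts H"
    using assms(5,6) by (auto simp: lex_product_def)
  have "(may_move G)\<^sup>*\<^sup>* g g'"
    using assms V by (intro connected_rtranclp_may_move)
  then have "?M\<^sup>*\<^sup>* (g, h) (g', h)"
  proof induction
    case base
    show ?case by simp
  next
    case (step y z)
    then have "?M (y, h) (z, h)"
      using V(2) by (auto simp: may_move_def lex_product_def dest: G.in_arcsD1 G.in_arcsD2)
    with step.IH show ?case
      by (rule rtranclp.rtrancl_into_rtrancl)
  qed
  also have "(may_move H)\<^sup>*\<^sup>* h h'"
    using assms V by (intro connected_rtranclp_may_move)
  then have "?M\<^sup>*\<^sup>* (g', h) (g', h')"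
  proof induction
    case base
    show ?case by simp
  next
    case (step y z)
    then have "?M (g', y) (g', z)"
      using V(3) by (auto simp: may_move_def lex_product_def dest: H.in_arcsD1 H.in_arcsD2)
    with step.IH show ?case
      by (rule rtranclp.rtrancl_into_rtrancl)
  qed
  finally show ?thesis
    by (simp add: uv)
qed

section \<open>Squads and extra cops on the product\<close>

locale lex_product_game =
  fixes G :: "'a pair_pre_digraph" and H :: "'b pair_pre_digraph"
    and a b :: nat and e :: "nat \<Rightarrow> 'b"
  assumes G: "pair_graph G" "Digraph_Component.connected (with_proj G)"
    and H: "pair_graph H" "Digraph_Component.connected (with_proj H)"
    and e: "bij_betw e {..<card (pverts H)} (pverts H)"
begin

sublocale G: pair_graph G by (rule G)
sublocale H: pair_graph H by (rule H)

abbreviation "m \<equiv> card (pverts H)"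
abbreviation "GH \<equiv> lex_product G H"

text \<open>Cop \<open>j < a * m\<close> is member \<open>j mod m\<close> of squad
  \<open>j div m\<close> and keeps its \<open>H\<close>-coordinate for good; the remaining
  \<open>b\<close> cops are the extra ones.\<close>

definition squads :: "(nat \<Rightarrow> 'a) \<Rightarrow> (nat \<Rightarrow> 'a \<times> 'b) \<Rightarrow> nat \<Rightarrow> 'a \<times> 'b" where
  "squads c d j = (if j < a * m then (c (j div m), e (j mod m)) else d (j - a * m))"

lemma card_pverts_H_pos: "0 < m"
  using H(2) by (auto simp: connected_conv card_gt_0_iff)

lemma e_mod_in_pverts: "e (j mod m) \<in> pverts H"
  using bij_betwE[OF e] card_pverts_H_pos by auto

lemma squads_index_cases:
  assumes "j < a * m + b"
  obtains (squad) "j < a * m" "j div m < a" | (extra) i where "j = a * m + i" "i < b"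
proof (cases "j < a * m")
  case True
  then show ?thesis
    using squad by (simp add: less_mult_imp_div_less)
next
  case False
  then show ?thesis
    using extra[of "j - a * m"] assms by auto
qed

lemma occupied_squads:
  "occupied (a * m + b) (squads c d) = occupied a c \<times> pverts H \<union> occupied b d"
proof (rule set_eqI, rule iffI)
  fix x assume "x \<in> occupied (a * m + b) (squads c d)"
  then obtain j where j: "j < a * m + b" "x = squads c d j"
    by (auto simp: occupied_def)
  from j(1) show "x \<in> occupied a c \<times> pverts H \<union> occupied b d"
    by (cases rule: squads_index_cases) (auto simp: j(2) squads_def occupied_def e_mod_in_pverts)
next
  fix x assume "x \<in> occupied a c \<times> pverts H \<union> occupied b d"
  then consider i l where "i < a" "l < m" "x = (c i, e l)" | i where "i < b" "x = d i"
    using bij_betw_imp_surj_on[OF e] unfolding occupied_def by (auto, blast)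
  then show "x \<in> occupied (a * m + b) (squads c d)"
  proof cases
    case (1 i l)
    have "i * m + l < Suc i * m"
      using 1(2) by simp
    also have "\<dots> \<le> a * m"
      using 1(1) by (intro mult_le_mono1) simp
    finally have lt: "i * m + l < a * m" .
    moreover have "(i * m + l) div m = i"
      using 1(2) by (intro div_nat_eqI) simp_all
    ultimately have "x = squads c d (i * m + l)"
      using 1(2,3) by (simp add: squads_def)
    then show ?thesis
      using lt by (auto simp: occupied_def)
  next
    case (2 i)
    then have "x = squads c d (a * m + i)"
      by (simp add: squads_def)
    then show ?thesis
      using 2(1) by (auto simp: occupied_def)
  qed
qed

text \<open>As squad members keep their \<open>H\<close>-coordinates, a move in \<open>G\<close>
  lifts to a move of the whole squad.\<close>

lemma may_move_squads:
  assumes "\<forall>i<a. may_move G (c i) (c' i)" "\<forall>i<b. may_move GH (d i) (d' i)"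
  shows "\<forall>j<a * m + b. may_move GH (squads c d j) (squads c' d' j)"
proof (intro allI impI)
  fix j assume "j < a * m + b"
  then show "may_move GH (squads c d j) (squads c' d' j)"
  proof (cases rule: squads_index_cases)
    case squad
    then have "may_move G (c (j div m)) (c' (j div m))"
      using assms(1) by blast
    then show ?thesis
      using squad e_mod_in_pverts[of j]
      by (auto simp: squads_def may_move_def lex_product_def dest: G.in_arcsD1 G.in_arcsD2)
  qed (use assms(2) in \<open>auto simp: squads_def\<close>)
qed

section \<open>The robber confined to one fibre\<close>

text \<open>Every arc leaving the fibre over \<open>g\<close> ends in the fibre over a neighbour of
  \<open>g\<close>, and a squad fills that fibre.\<close>

lemma confined_to_fibre:
  assumes "surrounded G a c g" "h \<in> pverts H"
    and "may_move GH (g, h) r" "r \<notin> occupied (a * m + b) (squads c d)"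
  obtains h' where "r = (g, h')" "h' \<in> pverts H" "may_move H h h'"
  using assms by (auto simp: occupied_squads surrounded_def may_move_def lex_product_def)

text \<open>The extra cops copy the game on \<open>H\<close> while the squads stand still. Once the
  robber is surrounded in \<open>H\<close>, his neighbours inside the fibre are held by extra cops
  and those outside by squads.\<close>

lemma cops_force_in_fibre:
  assumes "cops_force H b d h" "h \<in> pverts H" "g \<in> pverts G" "surrounded G a c g"
  shows "cops_force GH (a * m + b) (squads c (\<lambda>i. (g, d i))) (g, h)"
  using assms(1,2)
proof induction
  case (now d h)
  then show ?case
    using assms(4)
    by (intro cops_force.now)
      (fastforce simp: surrounded_def occupied_squads lex_product_def occupied_def[of b])
next
  case (move d d' h)
  have "\<forall>i<b. may_move GH (g, d i) (g, d' i)"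
    using move.hyps assms(3)
    by (auto simp: may_move_def lex_product_def dest: H.in_arcsD1 H.in_arcsD2)
  then have "\<forall>j<a * m + b. may_move GH (squads c (\<lambda>i. (g, d i)) j) (squads c (\<lambda>i. (g, d' i)) j)"
    by (intro may_move_squads) (auto simp: may_move_def)
  then show ?case
  proof (rule cops_force.move)
    fix r assume r: "may_move GH (g, h) r"
      "r \<notin> occupied (a * m + b) (squads c (\<lambda>i. (g, d' i)))"
    obtain h' where h': "r = (g, h')" "h' \<in> pverts H" "may_move H h h'"
      using confined_to_fibre[OF assms(4) move.prems r] .
    have "h' \<notin> occupied b d'"
      using r(2) by (auto simp: h'(1) occupied_squads occupied_def[of b])
    then show "cops_force GH (a * m + b) (squads c (\<lambda>i. (g, d' i))) r"
      using move.IH h' by simp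
  qed
qed

text \<open>Induction on the walk of the extra cops. The robber may wander in his fibre meanwhile,
  so \<open>h\<close> is arbitrary.\<close>

lemma cops_force_approach:
  assumes "(\<lambda>d d'. \<forall>i<b. may_move GH (d i) (d' i))\<^sup>*\<^sup>* d t"
    and "surrounded G a c g" "h \<in> pverts H"
    and target: "\<And>h'. h' \<in> pverts H \<Longrightarrow> (g, h') \<notin> occupied b t \<Longrightarrow>
      cops_force GH (a * m + b) (squads c t) (g, h')"
  shows "cops_force GH (a * m + b) (squads c d) (g, h)"
  using assms(1,3)
proof (induction arbitrary: h rule: converse_rtranclp_induct)
  case base
  \<comment> \<open>The robber may stand on a target vertex; staying put for one turn makes him leave it.\<close>
  have "\<forall>j<a * m + b. may_move GH (squads c t j) (squads c t j)"
    by (simp add: may_move_def)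
  then show ?case
  proof (rule cops_force.move)
    fix r assume r: "may_move GH (g, h) r" "r \<notin> occupied (a * m + b) (squads c t)"
    with confined_to_fibre[OF assms(2) base r] show "cops_force GH (a * m + b) (squads c t) r"
      by (metis UnCI occupied_squads target)
  qed
next
  case (step d d')
  have "\<forall>j<a * m + b. may_move GH (squads c d j) (squads c d' j)"
    using step.hyps(1) by (intro may_move_squads) (auto simp: may_move_def)
  then show ?case
  proof (rule cops_force.move)
    fix r assume r: "may_move GH (g, h) r" "r \<notin> occupied (a * m + b) (squads c d')"
    with confined_to_fibre[OF assms(2) step.prems r]
    show "cops_force GH (a * m + b) (squads c d') r"
      by (metis step.IH)
  qed
qed

section \<open>Combining the two games\<close>

text \<open>Induction on the projected game on \<open>G\<close>, with the extra cops waiting at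
  \<open>d\<close>. When the projected robber is surrounded, they walk to the winning placement
  \<open>t\<close> in his fibre.\<close>

lemma cops_force_lex_product:
  assumes "cops_force G a c g" "g \<in> pverts G" "h \<in> pverts H"
    and d: "\<forall>i<b. d i \<in> pverts GH"
    and t: "\<forall>i<b. t i \<in> pverts H"
    and win_H: "\<And>h. h \<in> pverts H \<Longrightarrow> h \<notin> occupied b t \<Longrightarrow> cops_force H b t h"
  shows "cops_force GH (a * m + b) (squads c d) (g, h)"
  using assms(1-3)
proof (induction arbitrary: h)
  case (now c g)
  have "\<forall>i<b. (may_move GH)\<^sup>*\<^sup>* (d i) (g, t i)"
  proof (intro allI impI rtranclp_may_move_lex_product G H)
    fix i assume "i < b"
    then show "d i \<in> pverts GH" "(g, t i) \<in> pverts GH"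
      using d t now.prems(1) by (auto simp: lex_product_def)
  qed
  then have "(\<lambda>d d'. \<forall>i<b. may_move GH (d i) (d' i))\<^sup>*\<^sup>* d (\<lambda>i. (g, t i))"
    by (rule rtranclp_may_move_simultaneous)
  then show ?case
  proof (rule cops_force_approach[OF _ now.hyps now.prems(2)])
    fix h' assume "h' \<in> pverts H" "(g, h') \<notin> occupied b (\<lambda>i. (g, t i))"
    then show "cops_force GH (a * m + b) (squads c (\<lambda>i. (g, t i))) (g, h')"
      using now win_H by (intro cops_force_in_fibre) (auto simp: occupied_def)
  qed
next
  case (move c c' g)
  have "\<forall>j<a * m + b. may_move GH (squads c d j) (squads c' d j)"
    using move.hyps by (intro may_move_squads) (auto simp: may_move_def)
  then show ?case
  proof (rule cops_force.move)
    fix r assume r: "may_move GH (g, h) r" "r \<notin> occupied (a * m + b) (squads c' d)"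
    obtain g' h' where r_eq: "r = (g', h')"
      by (cases r)
    have "may_move G g g'" "g' \<in> pverts G" "h' \<in> pverts H"
      using r(1) move.prems by (auto simp: r_eq may_move_def lex_product_def)
    \<comment> \<open>The fibre over an occupied vertex is full, so the robber's projection never
      lands on a cop.\<close>
    moreover from this(3) have "g' \<notin> occupied a c'"
      using r(2) by (simp add: r_eq occupied_squads)
    ultimately show "cops_force GH (a * m + b) (squads c' d) r"
      using move.IH by (simp add: r_eq)
  qed
qed

lemma cops_win_lex_product:
  assumes "cops_win G a" "cops_win H b"
  shows "cops_win GH (a * m + b)"
proof -
  obtain c where c: "\<forall>i<a. c i \<in> pverts G"
    "\<And>r. r \<in> pverts G \<Longrightarrow> r \<notin> occupied a c \<Longrightarrow> cops_force G a c r"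
    using cops_winD[OF assms(1)] G.in_arcsD1 G.in_arcsD2 by (metis mem_Sigma_iff subrelI)
  obtain t where t: "\<forall>i<b. t i \<in> pverts H"
    "\<And>r. r \<in> pverts H \<Longrightarrow> r \<notin> occupied b t \<Longrightarrow> cops_force H b t r"
    using cops_winD[OF assms(2)] H.in_arcsD1 H.in_arcsD2 by (metis mem_Sigma_iff subrelI)
  obtain g where g: "g \<in> pverts G"
    using G(2) by (auto simp: connected_conv)
  \<comment> \<open>Any vertices of the product would serve, since the extra cops walk to the
    robber's fibre later.\<close>
  define d where "d i = (g, t i)" for i
  have d: "\<forall>i<b. d i \<in> pverts GH"
    using g t(1) by (simp add: d_def lex_product_def)
  show ?thesis
  proof (rule cops_winI)
    show "\<forall>j<a * m + b. squads c d j \<in> pverts GH"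
    proof (intro allI impI)
      fix j assume "j < a * m + b"
      then show "squads c d j \<in> pverts GH"
        by (cases rule: squads_index_cases)
          (use c(1) d e_mod_in_pverts in \<open>auto simp: squads_def lex_product_def\<close>)
    qed
  next
    fix r assume r: "r \<in> pverts GH" "r \<notin> occupied (a * m + b) (squads c d)"
    obtain g' h' where r_eq: "r = (g', h')"
      by (cases r)
    have V: "g' \<in> pverts G" "h' \<in> pverts H"
      using r(1) by (auto simp: r_eq lex_product_def)
    then have "cops_force G a c g'"
      using r(2) by (intro c(2)) (auto simp: r_eq occupied_squads)
    then show "cops_force GH (a * m + b) (squads c d) r"
      unfolding r_eq using V d t by (rule cops_force_lex_product)
  qed
qed

end

theorem theorem22:
  fixes G :: "'a pair_pre_digraph" and H :: "'b pair_pre_digraph"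
  assumes "pair_graph G" and "Digraph_Component.connected (with_proj G)"
    and "pair_graph H" and "Digraph_Component.connected (with_proj H)"
  shows "surrounding_cop_number (lex_product G H)
           \<le> surrounding_cop_number G * card (pverts H) + surrounding_cop_number H"
proof -
  interpret G: pair_graph G by fact
  interpret H: pair_graph H by fact
  obtain e where "bij_betw e {..<card (pverts H)} (pverts H)"
    using ex_bij_betw_nat_finite[of "pverts H"] by (auto simp: atLeast0LessThan)
  then interpret lex_product_game G H "surrounding_cop_number G" "surrounding_cop_number H" e
    using assms by unfold_locales
  \<comment> \<open>Connectedness includes having at least one vertex.\<close>
  have "pverts G \<noteq> {}" "pverts H \<noteq> {}"
    using assms(2,4) by (auto simp: connected_conv)
  then have "cops_win G (surrounding_cop_number G)" "cops_win H (surrounding_cop_number H)"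
    "1 \<le> surrounding_cop_number H"
    using surrounding_cop_number[of G] surrounding_cop_number[of H] by simp_all
  then show ?thesis
    unfolding surrounding_cop_number_def[of "lex_product G H"]
    by (intro Least_le conjI cops_win_lex_product) auto
qed

end
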